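(* For every sequent $\Gamma \Rightarrow \Delta$ of first-order arithmetic: if $\mathrm{CPA} \vdash \Gamma \Rightarrow \Delta$ then $\mathrm{PA} \vdash \Gamma \Rightarrow \Delta$.
   Context: Language of first-order arithmetic: terms from variables, $0,S,+,\cdot$; formulas from $s=t,\bot,\wedge,\vee,\to,\forall,\exists$. Sequents $\Gamma\Rightarrow\Delta$ consist of finite sets $\Gamma,\Delta$ of formulas. $\mathrm{PA}$ is the classical (multi-conclusion) sequent calculus with the standard classical rules for first-order logic with equality, weakening and cut, the arithmetic axioms $\Rightarrow 0\neq St$, $Ss=St\Rightarrow s=t$, $\Rightarrow s+0=s$, $\Rightarrow s+St=S(s+t)$, $\Rightarrow s\cdot 0=0$, $\Rightarrow s\cdot St=(s\cdot t)+s$, and the induction axioms $\varphi(0),\forall x.\,\varphi(x)\to\varphi(Sx)\Rightarrow\varphi(s)$; proofs are finite trees. $\mathrm{CPA}$ (cyclic Peano arithmetic) has the rules of $\mathrm{PA}$ without induction axioms, plus $\textsc{Case}_x$: from $\Gamma[0/x]\Rightarrow\Delta[0/x]$ and $\Gamma[Sx/x]\Rightarrow\Delta[Sx/x]$ infer $\Gamma\Rightarrow\Delta$. A pre-proof is a finite tree with a partial map $\beta$ sending some leaves (buds) to inner nodes (companions), all non-bud nodes labelled by rule instances whose premises label the children, and each bud labelled by the sequent of its companion. An infinite branch starts at the root and each next node is a child of the current node or, for a bud, its companion. A variable $x$ has a progressing trace along an infinite branch if from some point on $x$ is free in every sequent of the branch and the branch passes instances of $\textsc{Case}_x$ infinitely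 often. A $\mathrm{CPA}$-proof is a pre-proof in which every infinite branch has a variable with a progressing trace. *)

theory Defs
  imports Main
begin

text \<open>
  Formulas are taken modulo renaming of bound variables, in locally nameless style: free
  variables carry names, bound variables are de Bruijn indices.  Quantified formulas are
  written in the usual named way through \<open>Forall x \<phi>\<close> and \<open>Exists x \<phi>\<close> below, which abstract
  the named variable \<open>x\<close> in \<open>\<phi>\<close>.
\<close>

type_synonym var = nat

datatype tm =
    Var var
  | Bound nat
  | Zero
  | Succ tm
  | Add tm tm
  | Mul tm tm

datatype fm =
    Eq tm tm
  | Falsity
  | And fm fm
  | Or fm fm
  | Imp fm fm
  | Uni fm
  | Exi fm

abbreviation Neg :: "fm \<Rightarrow> fm" where
  "Neg \<phi> \<equiv> Imp \<phi> Falsity"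

primrec fv_tm :: "tm \<Rightarrow> var set" where
  "fv_tm (Var y) = {y}"
| "fv_tm (Bound i) = {}"
| "fv_tm Zero = {}"
| "fv_tm (Succ s) = fv_tm s"
| "fv_tm (Add s t) = fv_tm s \<union> fv_tm t"
| "fv_tm (Mul s t) = fv_tm s \<union> fv_tm t"

primrec fv :: "fm \<Rightarrow> var set" where
  "fv (Eq s t) = fv_tm s \<union> fv_tm t"
| "fv Falsity = {}"
| "fv (And \<phi> \<psi>) = fv \<phi> \<union> fv \<psi>"
| "fv (Or \<phi> \<psi>) = fv \<phi> \<union> fv \<psi>"
| "fv (Imp \<phi> \<psi>) = fv \<phi> \<union> fv \<psi>"
| "fv (Uni \<phi>) = fv \<phi>"
| "fv (Exi \<phi>) = fv \<phi>"

text \<open>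
  \<open>lc_tm k\<close> and \<open>lc k\<close>: every index not bound inside the expression is below \<open>k\<close>.  The terms
  and formulas of arithmetic proper are those with \<open>k = 0\<close>, i.e. without dangling indices.
\<close>

primrec lc_tm :: "nat \<Rightarrow> tm \<Rightarrow> bool" where
  "lc_tm k (Var y) \<longleftrightarrow> True"
| "lc_tm k (Bound i) \<longleftrightarrow> i < k"
| "lc_tm k Zero \<longleftrightarrow> True"
| "lc_tm k (Succ s) \<longleftrightarrow> lc_tm k s"
| "lc_tm k (Add s t) \<longleftrightarrow> lc_tm k s \<and> lc_tm k t"
| "lc_tm k (Mul s t) \<longleftrightarrow> lc_tm k s \<and> lc_tm k t"

primrec lc :: "nat \<Rightarrow> fm \<Rightarrow> bool" where
  "lc k (Eq s t) \<longleftrightarrow> lc_tm k s \<and> lc_tm k t"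
| "lc k Falsity \<longleftrightarrow> True"
| "lc k (And \<phi> \<psi>) \<longleftrightarrow> lc k \<phi> \<and> lc k \<psi>"
| "lc k (Or \<phi> \<psi>) \<longleftrightarrow> lc k \<phi> \<and> lc k \<psi>"
| "lc k (Imp \<phi> \<psi>) \<longleftrightarrow> lc k \<phi> \<and> lc k \<psi>"
| "lc k (Uni \<phi>) \<longleftrightarrow> lc (Suc k) \<phi>"
| "lc k (Exi \<phi>) \<longleftrightarrow> lc (Suc k) \<phi>"

abbreviation is_term :: "tm \<Rightarrow> bool" where
  "is_term t \<equiv> lc_tm 0 t"

abbreviation is_formula :: "fm \<Rightarrow> bool" where
  "is_formula \<phi> \<equiv> lc 0 \<phi>"

text \<open>
  \<open>subst x t \<phi>\<close> is \<open>\<phi>[t/x]\<close>.  It is capture-avoiding as long as \<open>t\<close> has no dangling index,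
  which is why the quantifier and induction rules below require \<open>is_term t\<close>.
\<close>

primrec subst_tm :: "var \<Rightarrow> tm \<Rightarrow> tm \<Rightarrow> tm" where
  "subst_tm x t (Var y) = (if y = x then t else Var y)"
| "subst_tm x t (Bound i) = Bound i"
| "subst_tm x t Zero = Zero"
| "subst_tm x t (Succ r) = Succ (subst_tm x t r)"
| "subst_tm x t (Add r s) = Add (subst_tm x t r) (subst_tm x t s)"
| "subst_tm x t (Mul r s) = Mul (subst_tm x t r) (subst_tm x t s)"

primrec subst :: "var \<Rightarrow> tm \<Rightarrow> fm \<Rightarrow> fm" where
  "subst x t (Eq r s) = Eq (subst_tm x t r) (subst_tm x t s)"
| "subst x t Falsity = Falsity"
| "subst x t (And \<phi> \<psi>) = And (subst x t \<phi>) (subst x t \<psi>)"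
| "subst x t (Or \<phi> \<psi>) = Or (subst x t \<phi>) (subst x t \<psi>)"
| "subst x t (Imp \<phi> \<psi>) = Imp (subst x t \<phi>) (subst x t \<psi>)"
| "subst x t (Uni \<phi>) = Uni (subst x t \<phi>)"
| "subst x t (Exi \<phi>) = Exi (subst x t \<phi>)"

text \<open>
  \<open>abstr k x \<phi>\<close> replaces the free variable \<open>x\<close> by the index that points just outside \<open>\<phi>\<close>,
  where \<open>k\<close> counts the quantifiers passed so far.
\<close>

primrec abstr_tm :: "nat \<Rightarrow> var \<Rightarrow> tm \<Rightarrow> tm" where
  "abstr_tm k x (Var y) = (if y = x then Bound k else Var y)"
| "abstr_tm k x (Bound i) = Bound i"
| "abstr_tm k x Zero = Zero"
| "abstr_tm k x (Succ s) = Succ (abstr_tm k x s)"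
| "abstr_tm k x (Add s t) = Add (abstr_tm k x s) (abstr_tm k x t)"
| "abstr_tm k x (Mul s t) = Mul (abstr_tm k x s) (abstr_tm k x t)"

primrec abstr :: "nat \<Rightarrow> var \<Rightarrow> fm \<Rightarrow> fm" where
  "abstr k x (Eq s t) = Eq (abstr_tm k x s) (abstr_tm k x t)"
| "abstr k x Falsity = Falsity"
| "abstr k x (And \<phi> \<psi>) = And (abstr k x \<phi>) (abstr k x \<psi>)"
| "abstr k x (Or \<phi> \<psi>) = Or (abstr k x \<phi>) (abstr k x \<psi>)"
| "abstr k x (Imp \<phi> \<psi>) = Imp (abstr k x \<phi>) (abstr k x \<psi>)"
| "abstr k x (Uni \<phi>) = Uni (abstr (Suc k) x \<phi>)"
| "abstr k x (Exi \<phi>) = Exi (abstr (Suc k) x \<phi>)"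

definition Forall :: "var \<Rightarrow> fm \<Rightarrow> fm" where
  "Forall x \<phi> = Uni (abstr 0 x \<phi>)"

definition Exists :: "var \<Rightarrow> fm \<Rightarrow> fm" where
  "Exists x \<phi> = Exi (abstr 0 x \<phi>)"

datatype sequent = Sequent (antecedent: "fm set") (succedent: "fm set")  (infix "\<Rrightarrow>" 50)

definition is_sequent :: "sequent \<Rightarrow> bool" where
  "is_sequent S \<longleftrightarrow> finite (antecedent S) \<and> finite (succedent S) \<and>
     (\<forall>\<phi> \<in> antecedent S \<union> succedent S. is_formula \<phi>)"

definition fv_set :: "fm set \<Rightarrow> var set" where
  "fv_set \<Gamma> = (\<Union>\<phi>\<in>\<Gamma>. fv \<phi>)"

definition fv_sequent :: "sequent \<Rightarrow> var set" where
  "fv_sequent S = fv_set (antecedent S) \<union> fv_set (succedent S)"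

text \<open>
  \<open>basic_rule Ps C\<close>: from the premises \<open>Ps\<close> infer \<open>C\<close> by a rule common to PA and CPA.  As
  contexts are sets, a principal formula may also occur in the context, so contraction is
  built in.  In \<open>AllR\<close> and \<open>ExL\<close> the eigenvariable may be chosen freely, since
  \<open>Forall x \<phi> = Forall y (subst x (Var y) \<phi>)\<close> for every \<open>y\<close> not free in \<open>\<phi>\<close>.
\<close>

inductive basic_rule :: "sequent list \<Rightarrow> sequent \<Rightarrow> bool" where
  Ax: "basic_rule [] (insert \<phi> \<Gamma> \<Rrightarrow> insert \<phi> \<Delta>)"
| FalsityL: "basic_rule [] (insert Falsity \<Gamma> \<Rrightarrow> \<Delta>)"
| AndL: "basic_rule [insert \<phi> (insert \<psi> \<Gamma>) \<Rrightarrow> \<Delta>] (insert (And \<phi> \<psi>) \<Gamma> \<Rrightarrow> \<Delta>)"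
| AndR: "basic_rule [\<Gamma> \<Rrightarrow> insert \<phi> \<Delta>, \<Gamma> \<Rrightarrow> insert \<psi> \<Delta>] (\<Gamma> \<Rrightarrow> insert (And \<phi> \<psi>) \<Delta>)"
| OrL: "basic_rule [insert \<phi> \<Gamma> \<Rrightarrow> \<Delta>, insert \<psi> \<Gamma> \<Rrightarrow> \<Delta>] (insert (Or \<phi> \<psi>) \<Gamma> \<Rrightarrow> \<Delta>)"
| OrR: "basic_rule [\<Gamma> \<Rrightarrow> insert \<phi> (insert \<psi> \<Delta>)] (\<Gamma> \<Rrightarrow> insert (Or \<phi> \<psi>) \<Delta>)"
| ImpL: "basic_rule [\<Gamma> \<Rrightarrow> insert \<phi> \<Delta>, insert \<psi> \<Gamma> \<Rrightarrow> \<Delta>] (insert (Imp \<phi> \<psi>) \<Gamma> \<Rrightarrow> \<Delta>)"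
| ImpR: "basic_rule [insert \<phi> \<Gamma> \<Rrightarrow> insert \<psi> \<Delta>] (\<Gamma> \<Rrightarrow> insert (Imp \<phi> \<psi>) \<Delta>)"
| AllL: "is_term t \<Longrightarrow>
    basic_rule [insert (subst x t \<phi>) \<Gamma> \<Rrightarrow> \<Delta>] (insert (Forall x \<phi>) \<Gamma> \<Rrightarrow> \<Delta>)"
| AllR: "x \<notin> fv_set \<Gamma> \<union> fv_set \<Delta> \<Longrightarrow>
    basic_rule [\<Gamma> \<Rrightarrow> insert \<phi> \<Delta>] (\<Gamma> \<Rrightarrow> insert (Forall x \<phi>) \<Delta>)"
| ExL: "x \<notin> fv_set \<Gamma> \<union> fv_set \<Delta> \<Longrightarrow>
    basic_rule [insert \<phi> \<Gamma> \<Rrightarrow> \<Delta>] (insert (Exists x \<phi>) \<Gamma> \<Rrightarrow> \<Delta>)"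
| ExR: "is_term t \<Longrightarrow>
    basic_rule [\<Gamma> \<Rrightarrow> insert (subst x t \<phi>) \<Delta>] (\<Gamma> \<Rrightarrow> insert (Exists x \<phi>) \<Delta>)"
| EqL: "is_term s \<Longrightarrow> is_term t \<Longrightarrow>
    basic_rule [subst x t ` \<Gamma> \<Rrightarrow> subst x t ` \<Delta>]
      (insert (Eq s t) (subst x s ` \<Gamma>) \<Rrightarrow> subst x s ` \<Delta>)"
| EqR: "basic_rule [] (\<Gamma> \<Rrightarrow> insert (Eq t t) \<Delta>)"
| Weak: "\<Gamma> \<subseteq> \<Gamma>' \<Longrightarrow> \<Delta> \<subseteq> \<Delta>' \<Longrightarrow> basic_rule [\<Gamma> \<Rrightarrow> \<Delta>] (\<Gamma>' \<Rrightarrow> \<Delta>')"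
| Cut: "basic_rule [\<Gamma> \<Rrightarrow> insert \<phi> \<Delta>, insert \<phi> \<Gamma> \<Rrightarrow> \<Delta>] (\<Gamma> \<Rrightarrow> \<Delta>)"
| Zero_neq_Succ: "basic_rule [] ({} \<Rrightarrow> {Neg (Eq Zero (Succ t))})"
| Succ_inj: "basic_rule [] ({Eq (Succ s) (Succ t)} \<Rrightarrow> {Eq s t})"
| Add_Zero: "basic_rule [] ({} \<Rrightarrow> {Eq (Add s Zero) s})"
| Add_Succ: "basic_rule [] ({} \<Rrightarrow> {Eq (Add s (Succ t)) (Succ (Add s t))})"
| Mul_Zero: "basic_rule [] ({} \<Rrightarrow> {Eq (Mul s Zero) Zero})"
| Mul_Succ: "basic_rule [] ({} \<Rrightarrow> {Eq (Mul s (Succ t)) (Add (Mul s t) s)})"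

inductive PA_provable :: "sequent \<Rightarrow> bool" where
  Basic: "basic_rule Ps C \<Longrightarrow> is_sequent C \<Longrightarrow> (\<And>P. P \<in> set Ps \<Longrightarrow> PA_provable P) \<Longrightarrow>
    PA_provable C"
| Induction: "is_term s \<Longrightarrow> is_formula \<phi> \<Longrightarrow>
    PA_provable ({subst x Zero \<phi>, Forall x (Imp \<phi> (subst x (Succ (Var x)) \<phi>))} \<Rrightarrow>
      {subst x s \<phi>})"

datatype rule_label = BasicRule | CaseRule var

inductive CPA_rule :: "rule_label \<Rightarrow> sequent list \<Rightarrow> sequent \<Rightarrow> bool" where
  Basic: "basic_rule Ps C \<Longrightarrow> CPA_rule BasicRule Ps C"
| Case: "CPA_rule (CaseRule x)
    [subst x Zero ` \<Gamma> \<Rrightarrow> subst x Zero ` \<Delta>,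
     subst x (Succ (Var x)) ` \<Gamma> \<Rrightarrow> subst x (Succ (Var x)) ` \<Delta>]
    (\<Gamma> \<Rrightarrow> \<Delta>)"

text \<open>
  Nodes are addresses: \<open>[]\<close> is the root and \<open>v @ [i]\<close> the \<open>i\<close>-th child of \<open>v\<close>.  The field
  \<open>companion\<close> is the partial map \<open>\<beta>\<close>, whose domain are the buds; the rule label of a bud is
  ignored.
\<close>

type_synonym node = "nat list"

record derivation =
  nodes :: "node set"
  seq_at :: "node \<Rightarrow> sequent"
  rule_at :: "node \<Rightarrow> rule_label"
  companion :: "node \<Rightarrow> node option"

definition finite_tree :: "node set \<Rightarrow> bool" where
  "finite_tree N \<longleftrightarrow> finite N \<and> [] \<in> N \<and>
     (\<forall>v i. v @ [i] \<in> N \<longrightarrow> v \<in> N \<and> (\<forall>j<i. v @ [j] \<in> N))"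

definition arity :: "node set \<Rightarrow> node \<Rightarrow> nat" where
  "arity N v = card {i. v @ [i] \<in> N}"

definition leaf :: "node set \<Rightarrow> node \<Rightarrow> bool" where
  "leaf N v \<longleftrightarrow> v \<in> N \<and> (\<forall>i. v @ [i] \<notin> N)"

definition inner_node :: "node set \<Rightarrow> node \<Rightarrow> bool" where
  "inner_node N v \<longleftrightarrow> v \<in> N \<and> \<not> leaf N v"

definition preproof :: "derivation \<Rightarrow> bool" where
  "preproof D \<longleftrightarrow>
     finite_tree (nodes D) \<and>
     (\<forall>v \<in> nodes D. is_sequent (seq_at D v)) \<and>
     (\<forall>v c. companion D v = Some c \<longrightarrow>
        leaf (nodes D) v \<and> inner_node (nodes D) c \<and> seq_at D v = seq_at D c) \<and>
     (\<forall>v \<in> nodes D. companion D v = None \<longrightarrow>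
        CPA_rule (rule_at D v)
          (map (\<lambda>i. seq_at D (v @ [i])) [0..<arity (nodes D) v]) (seq_at D v))"

definition infinite_branch :: "derivation \<Rightarrow> (nat \<Rightarrow> node) \<Rightarrow> bool" where
  "infinite_branch D b \<longleftrightarrow> b 0 = [] \<and>
     (\<forall>n. b n \<in> nodes D \<and>
        ((\<exists>i. b (Suc n) = b n @ [i]) \<or> companion D (b n) = Some (b (Suc n))))"

definition progressing_trace :: "derivation \<Rightarrow> (nat \<Rightarrow> node) \<Rightarrow> var \<Rightarrow> bool" where
  "progressing_trace D b x \<longleftrightarrow>
     (\<exists>m. \<forall>n\<ge>m. x \<in> fv_sequent (seq_at D (b n))) \<and>
     infinite {n. companion D (b n) = None \<and> rule_at D (b n) = CaseRule x}"

definition CPA_proof :: "derivation \<Rightarrow> bool" where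
  "CPA_proof D \<longleftrightarrow> preproof D \<and>
     (\<forall>b. infinite_branch D b \<longrightarrow> (\<exists>x. progressing_trace D b x))"

definition CPA_provable :: "sequent \<Rightarrow> bool" where
  "CPA_provable S \<longleftrightarrow> (\<exists>D. CPA_proof D \<and> seq_at D [] = S)"

end

theory Submission
  imports Defs
begin

text \<open>
  Consider a set \<open>U\<close> of nodes whose exits are already provable from hypotheses \<open>\<Theta>\<close>, and argue by
  induction on the size of \<open>U\<close>.  If \<open>U\<close> is not strongly connected, it splits into smaller sets.
  Otherwise some infinite branch visits exactly \<open>U\<close> infinitely often, which yields a variable \<open>x\<close>
  that is free in all sequents of \<open>U\<close> and has a \<open>Case\<close>-node in \<open>U\<close>.  Let \<open>A(x)\<close> be the
  conjunction of all sequents in \<open>U\<close>, universally closed except over \<open>x\<close> and the variables of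
  \<open>\<Theta>\<close>, and let \<open>B(x)\<close> say that \<open>A\<close> holds at the predecessor of \<open>x\<close>, if there is one.  With
  \<open>B(x)\<close> as a further hypothesis the \<open>Case\<close>-nodes on \<open>x\<close> become provable outright and can be
  dropped from \<open>U\<close>, so that \<open>B(x)\<close> entails \<open>A(x)\<close>; induction on \<open>x\<close> gives \<open>A(x)\<close>.  The
  hypotheses survive the eigenvariable rules because their free variables occur in every sequent
  of \<open>U\<close>.
\<close>

section \<open>Syntax\<close>

lemma subst_tm_Var_self [simp]: "subst_tm x (Var x) t = t"
  by (induction t) auto

lemma subst_Var_self [simp]: "subst x (Var x) \<phi> = \<phi>"
  by (induction \<phi>) auto

lemma subst_tm_fresh: "x \<notin> fv_tm s \<Longrightarrow> subst_tm x t s = s"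
  by (induction s) auto

lemma subst_fresh: "x \<notin> fv \<phi> \<Longrightarrow> subst x t \<phi> = \<phi>"
  by (induction \<phi>) (auto simp: subst_tm_fresh)

lemma fv_subst_tm: "fv_tm (subst_tm x t s) \<subseteq> fv_tm s - {x} \<union> fv_tm t"
  by (induction s) auto

lemma fv_subst: "fv (subst x t \<phi>) \<subseteq> fv \<phi> - {x} \<union> fv_tm t"
proof (induction \<phi>)
  case (Eq r s)
  then show ?case using fv_subst_tm[of x t r] fv_subst_tm[of x t s] by auto
qed auto

lemma subst_tm_subst_tm_Var: "z \<notin> fv_tm s \<Longrightarrow> subst_tm z t (subst_tm x (Var z) s) = subst_tm x t s"
  by (induction s) auto

lemma subst_subst_Var: "z \<notin> fv \<phi> \<Longrightarrow> subst z t (subst x (Var z) \<phi>) = subst x t \<phi>"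
  by (induction \<phi>) (auto simp: subst_tm_subst_tm_Var)

lemma lc_tm_mono: "lc_tm k t \<Longrightarrow> k \<le> l \<Longrightarrow> lc_tm l t"
  by (induction t) auto

lemma lc_tm_subst: "lc_tm k s \<Longrightarrow> is_term t \<Longrightarrow> lc_tm k (subst_tm x t s)"
  by (induction s) (auto intro: lc_tm_mono)

lemma lc_subst [simp]: "lc k \<phi> \<Longrightarrow> is_term t \<Longrightarrow> lc k (subst x t \<phi>)"
  by (induction \<phi> arbitrary: k) (auto intro: lc_tm_subst)

lemma lc_tm_abstr: "lc_tm k s \<Longrightarrow> lc_tm (Suc k) (abstr_tm k x s)"
  by (induction s) auto

lemma lc_abstr: "lc k \<phi> \<Longrightarrow> lc (Suc k) (abstr k x \<phi>)"
  by (induction \<phi> arbitrary: k) (auto intro: lc_tm_abstr)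

lemma lc_Forall [simp]: "is_formula \<phi> \<Longrightarrow> is_formula (Forall x \<phi>)"
  by (simp add: Forall_def lc_abstr)

lemma fv_tm_abstr: "fv_tm (abstr_tm k x s) = fv_tm s - {x}"
  by (induction s) auto

lemma fv_abstr: "fv (abstr k x \<phi>) = fv \<phi> - {x}"
  by (induction \<phi> arbitrary: k) (auto simp: fv_tm_abstr)

lemma fv_Forall [simp]: "fv (Forall x \<phi>) = fv \<phi> - {x}"
  by (simp add: Forall_def fv_abstr)

lemma fv_Exists [simp]: "fv (Exists x \<phi>) = fv \<phi> - {x}"
  by (simp add: Exists_def fv_abstr)

lemma abstr_tm_subst_tm:
  "z \<noteq> x \<Longrightarrow> z \<notin> fv_tm t \<Longrightarrow> abstr_tm k z (subst_tm x t s) = subst_tm x t (abstr_tm k z s)"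
proof (induction s)
  case (Var y)
  \<comment> \<open>The substituted term avoids \<open>z\<close>, so abstracting \<open>z\<close>
    leaves it unchanged.\<close>
  moreover have "z \<notin> fv_tm r \<Longrightarrow> abstr_tm k z r = r" for r by (induction r) auto
  ultimately show ?case by auto
qed auto

lemma abstr_subst:
  "z \<noteq> x \<Longrightarrow> z \<notin> fv_tm t \<Longrightarrow> abstr k z (subst x t \<phi>) = subst x t (abstr k z \<phi>)"
  by (induction \<phi> arbitrary: k) (auto simp: abstr_tm_subst_tm)

lemma subst_Forall:
  "z \<noteq> x \<Longrightarrow> z \<notin> fv_tm t \<Longrightarrow> subst x t (Forall z \<phi>) = Forall z (subst x t \<phi>)"
  by (simp add: Forall_def abstr_subst)

lemma finite_fv_tm: "finite (fv_tm t)"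
  by (induction t) auto

lemma finite_fv [simp]: "finite (fv \<phi>)"
  by (induction \<phi>) (auto simp: finite_fv_tm)

lemma finite_fv_set [simp]: "finite \<Gamma> \<Longrightarrow> finite (fv_set \<Gamma>)"
  by (simp add: fv_set_def)

lemma fv_set_simps [simp]:
  "fv_set {} = {}"
  "fv_set (insert \<phi> \<Gamma>) = fv \<phi> \<union> fv_set \<Gamma>"
  "fv_set (\<Gamma> \<union> \<Gamma>') = fv_set \<Gamma> \<union> fv_set \<Gamma>'"
  by (auto simp: fv_set_def)

lemma is_sequent_iff:
  "is_sequent (\<Gamma> \<Rrightarrow> \<Delta>) \<longleftrightarrow>
     finite \<Gamma> \<and> finite \<Delta> \<and> (\<forall>\<phi>\<in>\<Gamma>. is_formula \<phi>) \<and> (\<forall>\<phi>\<in>\<Delta>. is_formula \<phi>)"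
  by (auto simp: is_sequent_def)

section \<open>Derived rules of PA\<close>

lemma PA_provable_is_sequent: "PA_provable S \<Longrightarrow> is_sequent S"
  by (induction rule: PA_provable.induct) (auto simp: is_sequent_iff)

lemma PA_basic:
  assumes "basic_rule Ps C" "is_sequent C" "\<forall>P\<in>set Ps. PA_provable P"
  shows "PA_provable C"
  using assms by (auto intro: PA_provable.Basic)

lemma PA_weaken:
  assumes "PA_provable (\<Gamma> \<Rrightarrow> \<Delta>)" "\<Gamma> \<subseteq> \<Gamma>'" "\<Delta> \<subseteq> \<Delta>'" "is_sequent (\<Gamma>' \<Rrightarrow> \<Delta>')"
  shows "PA_provable (\<Gamma>' \<Rrightarrow> \<Delta>')"
  by (rule PA_basic[OF basic_rule.Weak[OF assms(2,3)] assms(4)]) (simp add: assms(1))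

lemma PA_axiom:
  assumes "is_sequent (\<Gamma> \<Rrightarrow> \<Delta>)" "\<phi> \<in> \<Gamma>" "\<phi> \<in> \<Delta>"
  shows "PA_provable (\<Gamma> \<Rrightarrow> \<Delta>)"
  using PA_basic[OF basic_rule.Ax[of \<phi> \<Gamma> \<Delta>]] assms by (simp add: insert_absorb)

lemma PA_cut:
  assumes "PA_provable (\<Gamma> \<Rrightarrow> insert \<phi> \<Delta>)" "PA_provable (insert \<phi> \<Gamma> \<Rrightarrow> \<Delta>)"
  shows "PA_provable (\<Gamma> \<Rrightarrow> \<Delta>)"
  using PA_provable_is_sequent[OF assms(1)] assms
  by (intro PA_basic[OF basic_rule.Cut[of \<Gamma> \<phi> \<Delta>]]) (auto simp: is_sequent_iff)

lemma PA_cut_single: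
  assumes "PA_provable (\<Gamma> \<Rrightarrow> {\<phi>})" "PA_provable (insert \<phi> \<Gamma> \<Rrightarrow> \<Delta>)"
  shows "PA_provable (\<Gamma> \<Rrightarrow> \<Delta>)"
proof (rule PA_cut)
  show "PA_provable (\<Gamma> \<Rrightarrow> insert \<phi> \<Delta>)"
    using assms(1) by (rule PA_weaken)
      (use assms[THEN PA_provable_is_sequent] in \<open>auto simp: is_sequent_iff\<close>)
qed fact

section \<open>Inverting the right rules\<close>

lemma PA_Falsity_iff: "PA_provable (\<Gamma> \<Rrightarrow> insert Falsity \<Delta>) \<longleftrightarrow> PA_provable (\<Gamma> \<Rrightarrow> \<Delta>)"
proof
  assume *: "PA_provable (\<Gamma> \<Rrightarrow> insert Falsity \<Delta>)"
  show "PA_provable (\<Gamma> \<Rrightarrow> \<Delta>)"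
    by (rule PA_cut[OF *], rule PA_basic[OF basic_rule.FalsityL])
      (use PA_provable_is_sequent[OF *] in \<open>auto simp: is_sequent_iff\<close>)
next
  assume *: "PA_provable (\<Gamma> \<Rrightarrow> \<Delta>)"
  show "PA_provable (\<Gamma> \<Rrightarrow> insert Falsity \<Delta>)"
    by (rule PA_weaken[OF *]) (use PA_provable_is_sequent[OF *] in \<open>auto simp: is_sequent_iff\<close>)
qed

text \<open>The inversion is a cut on the disjunction, which \<open>OrL\<close> breaks up into two
  axioms. As an equivalence it lets the simplifier pass between formulas and sequents.\<close>

lemma PA_Or_iff:
  "PA_provable (\<Gamma> \<Rrightarrow> insert (Or \<phi> \<psi>) \<Delta>) \<longleftrightarrow> PA_provable (\<Gamma> \<Rrightarrow> insert \<phi> (insert \<psi> \<Delta>))"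
proof
  assume *: "PA_provable (\<Gamma> \<Rrightarrow> insert (Or \<phi> \<psi>) \<Delta>)"
  have seq: "is_sequent (\<Gamma> \<Rrightarrow> insert (Or \<phi> \<psi>) (insert \<phi> (insert \<psi> \<Delta>)))"
    using PA_provable_is_sequent[OF *] by (auto simp: is_sequent_iff)
  show "PA_provable (\<Gamma> \<Rrightarrow> insert \<phi> (insert \<psi> \<Delta>))"
  proof (rule PA_cut)
    show "PA_provable (\<Gamma> \<Rrightarrow> insert (Or \<phi> \<psi>) (insert \<phi> (insert \<psi> \<Delta>)))"
      by (rule PA_weaken[OF * _ _ seq]) auto
    show "PA_provable (insert (Or \<phi> \<psi>) \<Gamma> \<Rrightarrow> insert \<phi> (insert \<psi> \<Delta>))"
      by (rule PA_basic[OF basic_rule.OrL])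
        (use seq in \<open>auto simp: is_sequent_iff intro: PA_axiom\<close>)
  qed
next
  assume *: "PA_provable (\<Gamma> \<Rrightarrow> insert \<phi> (insert \<psi> \<Delta>))"
  show "PA_provable (\<Gamma> \<Rrightarrow> insert (Or \<phi> \<psi>) \<Delta>)"
    by (rule PA_basic[OF basic_rule.OrR])
      (use * PA_provable_is_sequent[OF *] in \<open>auto simp: is_sequent_iff\<close>)
qed

lemma PA_Imp_iff: "PA_provable (\<Gamma> \<Rrightarrow> {Imp \<phi> \<psi>}) \<longleftrightarrow> PA_provable (insert \<phi> \<Gamma> \<Rrightarrow> {\<psi>})"
proof
  assume *: "PA_provable (\<Gamma> \<Rrightarrow> {Imp \<phi> \<psi>})"
  have seq: "is_sequent (insert \<phi> \<Gamma> \<Rrightarrow> {\<psi>, Imp \<phi> \<psi>})"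
    using PA_provable_is_sequent[OF *] by (auto simp: is_sequent_iff)
  show "PA_provable (insert \<phi> \<Gamma> \<Rrightarrow> {\<psi>})"
  proof (rule PA_cut_single)
    show "PA_provable (insert \<phi> \<Gamma> \<Rrightarrow> {Imp \<phi> \<psi>})"
      by (rule PA_weaken[OF *]) (use seq in \<open>auto simp: is_sequent_iff\<close>)
    show "PA_provable (insert (Imp \<phi> \<psi>) (insert \<phi> \<Gamma>) \<Rrightarrow> {\<psi>})"
      by (rule PA_basic[OF basic_rule.ImpL])
        (use seq in \<open>auto simp: is_sequent_iff intro: PA_axiom\<close>)
  qed
next
  assume *: "PA_provable (insert \<phi> \<Gamma> \<Rrightarrow> {\<psi>})"
  show "PA_provable (\<Gamma> \<Rrightarrow> {Imp \<phi> \<psi>})"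
    by (rule PA_basic[OF basic_rule.ImpR])
      (use * PA_provable_is_sequent[OF *] in \<open>auto simp: is_sequent_iff\<close>)
qed

lemma PA_AndI:
  assumes "PA_provable (\<Gamma> \<Rrightarrow> {\<phi>})" "PA_provable (\<Gamma> \<Rrightarrow> {\<psi>})"
  shows "PA_provable (\<Gamma> \<Rrightarrow> {And \<phi> \<psi>})"
  by (rule PA_basic[OF basic_rule.AndR])
    (use assms assms[THEN PA_provable_is_sequent] in \<open>auto simp: is_sequent_iff\<close>)

lemma PA_AndE:
  assumes "PA_provable (\<Gamma> \<Rrightarrow> {And \<phi> \<psi>})" "\<chi> \<in> {\<phi>, \<psi>}"
  shows "PA_provable (\<Gamma> \<Rrightarrow> {\<chi>})"
proof (rule PA_cut_single[OF assms(1)])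
  show "PA_provable (insert (And \<phi> \<psi>) \<Gamma> \<Rrightarrow> {\<chi>})"
    by (rule PA_basic[OF basic_rule.AndL])
      (use assms(2) PA_provable_is_sequent[OF assms(1)] in
        \<open>auto simp: is_sequent_iff intro: PA_axiom\<close>)
qed

lemma PA_AllI:
  assumes "PA_provable (\<Gamma> \<Rrightarrow> {\<phi>})" "x \<notin> fv_set \<Gamma>"
  shows "PA_provable (\<Gamma> \<Rrightarrow> {Forall x \<phi>})"
  by (rule PA_basic[OF basic_rule.AllR[where \<Delta> = "{}"]])
    (use assms PA_provable_is_sequent[OF assms(1)] in \<open>auto simp: is_sequent_iff\<close>)

lemma PA_AllE:
  assumes "PA_provable (\<Gamma> \<Rrightarrow> {Forall x \<phi>})" "is_formula \<phi>" "is_term t"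
  shows "PA_provable (\<Gamma> \<Rrightarrow> {subst x t \<phi>})"
proof (rule PA_cut_single[OF assms(1)])
  show "PA_provable (insert (Forall x \<phi>) \<Gamma> \<Rrightarrow> {subst x t \<phi>})"
    by (rule PA_basic[OF basic_rule.AllL[OF assms(3)]])
      (use assms(2,3) PA_provable_is_sequent[OF assms(1)] in
        \<open>auto simp: is_sequent_iff intro: PA_axiom\<close>)
qed

section \<open>Substitution, induction and equality\<close>

lemma PA_subst:
  assumes "PA_provable (\<Gamma> \<Rrightarrow> {\<phi>})" "x \<notin> fv_set \<Gamma>" "is_term t"
  shows "PA_provable (\<Gamma> \<Rrightarrow> {subst x t \<phi>})"
  using PA_AllE[OF PA_AllI[OF assms(1,2)] _ assms(3)] PA_provable_is_sequent[OF assms(1)]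
  by (auto simp: is_sequent_iff)

text \<open>The induction axiom at the term \<open>Var x\<close> concludes \<open>\<phi>\<close>
  itself. Freshness of \<open>x\<close> in the context allows the step to be generalised, and two
  cuts remove both premises of the axiom.\<close>

lemma PA_induct:
  assumes "PA_provable (\<Gamma> \<Rrightarrow> {subst x Zero \<phi>})"
    and step: "PA_provable (insert \<phi> \<Gamma> \<Rrightarrow> {subst x (Succ (Var x)) \<phi>})"
    and "x \<notin> fv_set \<Gamma>"
  shows "PA_provable (\<Gamma> \<Rrightarrow> {\<phi>})"
proof -
  let ?step = "Forall x (Imp \<phi> (subst x (Succ (Var x)) \<phi>))"
  have seq: "is_sequent (insert (subst x Zero \<phi>) (insert ?step \<Gamma>) \<Rrightarrow> {\<phi>})"
    using step[THEN PA_provable_is_sequent] by (auto simp: is_sequent_iff)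
  have "PA_provable (insert (subst x Zero \<phi>) (insert ?step \<Gamma>) \<Rrightarrow> {\<phi>})"
    by (rule PA_weaken[OF PA_provable.Induction[of "Var x" \<phi> x]])
      (use seq in \<open>auto simp: is_sequent_iff\<close>)
  moreover have "PA_provable (insert ?step \<Gamma> \<Rrightarrow> {subst x Zero \<phi>})"
    by (rule PA_weaken[OF assms(1)]) (use seq in \<open>auto simp: is_sequent_iff\<close>)
  ultimately have "PA_provable (insert ?step \<Gamma> \<Rrightarrow> {\<phi>})"
    by (rule PA_cut_single[rotated])
  moreover have "PA_provable (\<Gamma> \<Rrightarrow> {?step})"
    using step assms(3) by (simp add: PA_AllI PA_Imp_iff)
  ultimately show ?thesis
    by (rule PA_cut_single[rotated])
qed

text \<open>Induction in which the induction hypothesis is never consulted.\<close>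

lemma PA_cases:
  assumes "PA_provable (\<Gamma> \<Rrightarrow> {subst x Zero \<phi>})"
    and "PA_provable (\<Gamma> \<Rrightarrow> {subst x (Succ (Var x)) \<phi>})"
    and "x \<notin> fv_set \<Gamma>" "is_formula \<phi>"
  shows "PA_provable (\<Gamma> \<Rrightarrow> {\<phi>})"
  by (rule PA_induct[OF assms(1) PA_weaken[OF assms(2)] assms(3)])
    (use assms(4) PA_provable_is_sequent[OF assms(2)] in \<open>auto simp: is_sequent_iff\<close>)

text \<open>\<open>EqL\<close> rewrites both sides of a sequent. The succedent is therefore taken
  with \<open>t\<close> already substituted: as \<open>x\<close> is not in \<open>t\<close>, it no
  longer contains \<open>x\<close> and stays fixed, and the premise is an axiom.\<close>

lemma PA_eq_subst:
  assumes "is_term s" "is_term t" "is_formula \<phi>" "x \<notin> fv_tm t"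
  shows "PA_provable ({Eq s t, subst x s \<phi>} \<Rrightarrow> {subst x t \<phi>})"
proof -
  have fresh: "subst x r (subst x t \<phi>) = subst x t \<phi>" for r
    using fv_subst[of x t \<phi>] assms(4) by (intro subst_fresh) auto
  have "basic_rule [{subst x t \<phi>} \<Rrightarrow> {subst x t \<phi>}] ({Eq s t, subst x s \<phi>} \<Rrightarrow> {subst x t \<phi>})"
    using basic_rule.EqL[OF assms(1,2), of x "{\<phi>}" "{subst x t \<phi>}"] by (simp add: fresh)
  then show ?thesis
    by (rule PA_basic) (use assms in \<open>auto simp: is_sequent_iff intro: PA_axiom\<close>)
qed

section \<open>Sequents as formulas\<close>

text \<open>An arbitrary enumeration, meaningful only for finite sets.\<close>

definition list_of :: "'a set \<Rightarrow> 'a list" where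
  "list_of A = (SOME xs. set xs = A)"

lemma set_list_of [simp]: "finite A \<Longrightarrow> set (list_of A) = A"
  unfolding list_of_def by (rule someI_ex) (rule finite_list)

definition disjs :: "fm list \<Rightarrow> fm" where
  "disjs \<phi>s = foldr Or \<phi>s Falsity"

text \<open>The language has no constant for truth, so the empty conjunction is an implication that
  always holds.\<close>

definition conjs :: "fm list \<Rightarrow> fm" where
  "conjs \<phi>s = foldr And \<phi>s (Imp Falsity Falsity)"

definition imps :: "fm list \<Rightarrow> fm \<Rightarrow> fm" where
  "imps \<phi>s \<psi> = foldr Imp \<phi>s \<psi>"

definition Foralls :: "var list \<Rightarrow> fm \<Rightarrow> fm" where
  "Foralls xs \<phi> = foldr Forall xs \<phi>"

definition sequent_fm :: "sequent \<Rightarrow> fm" where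
  "sequent_fm S = imps (list_of (antecedent S)) (disjs (list_of (succedent S)))"

lemma PA_disjs_iff:
  "PA_provable (\<Gamma> \<Rrightarrow> insert (disjs \<phi>s) \<Delta>) \<longleftrightarrow> PA_provable (\<Gamma> \<Rrightarrow> set \<phi>s \<union> \<Delta>)"
proof (induction \<phi>s arbitrary: \<Delta>)
  case Nil
  then show ?case by (simp add: disjs_def PA_Falsity_iff)
next
  case (Cons \<phi> \<phi>s)
  have "PA_provable (\<Gamma> \<Rrightarrow> insert (disjs (\<phi> # \<phi>s)) \<Delta>) \<longleftrightarrow>
    PA_provable (\<Gamma> \<Rrightarrow> insert (disjs \<phi>s) (insert \<phi> \<Delta>))"
    by (simp add: disjs_def PA_Or_iff insert_commute)
  then show ?case by (simp add: Cons.IH)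
qed

lemma PA_imps_iff: "PA_provable (\<Gamma> \<Rrightarrow> {imps \<phi>s \<psi>}) \<longleftrightarrow> PA_provable (\<Gamma> \<union> set \<phi>s \<Rrightarrow> {\<psi>})"
  by (induction \<phi>s arbitrary: \<Gamma>) (auto simp: imps_def PA_Imp_iff)

lemma PA_conjsI:
  assumes "is_sequent (\<Gamma> \<Rrightarrow> {})" "\<forall>\<phi>\<in>set \<phi>s. PA_provable (\<Gamma> \<Rrightarrow> {\<phi>})"
  shows "PA_provable (\<Gamma> \<Rrightarrow> {conjs \<phi>s})"
  using assms(2)
proof (induction \<phi>s)
  case Nil
  have "PA_provable (insert Falsity \<Gamma> \<Rrightarrow> {Falsity})"
    using assms(1) by (intro PA_axiom[of _ _ Falsity]) (auto simp: is_sequent_iff)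
  then show ?case by (simp add: conjs_def PA_Imp_iff)
qed (auto simp: conjs_def intro: PA_AndI)

lemma PA_conjsE: "PA_provable (\<Gamma> \<Rrightarrow> {conjs \<phi>s}) \<Longrightarrow> \<phi> \<in> set \<phi>s \<Longrightarrow> PA_provable (\<Gamma> \<Rrightarrow> {\<phi>})"
  by (induction \<phi>s) (auto simp: conjs_def dest: PA_AndE)

lemma PA_ForallsI:
  assumes "PA_provable (\<Gamma> \<Rrightarrow> {\<phi>})" "set xs \<inter> fv_set \<Gamma> = {}"
  shows "PA_provable (\<Gamma> \<Rrightarrow> {Foralls xs \<phi>})"
  using assms(2) by (induction xs) (auto simp: Foralls_def assms(1) intro: PA_AllI)

lemma is_formula_Foralls [simp]: "is_formula \<phi> \<Longrightarrow> is_formula (Foralls xs \<phi>)"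
  by (induction xs) (auto simp: Foralls_def)

lemma fv_Foralls [simp]: "fv (Foralls xs \<phi>) = fv \<phi> - set xs"
  by (induction xs) (auto simp: Foralls_def)

text \<open>Each quantifier is instantiated by its own variable, which gives back the matrix
  unchanged.\<close>

lemma PA_ForallsE:
  "PA_provable (\<Gamma> \<Rrightarrow> {Foralls xs \<phi>}) \<Longrightarrow> is_formula \<phi> \<Longrightarrow> PA_provable (\<Gamma> \<Rrightarrow> {\<phi>})"
proof (induction xs)
  case (Cons x xs)
  then show ?case
    using PA_AllE[of \<Gamma> x "Foralls xs \<phi>" "Var x"] is_formula_Foralls[of \<phi> xs]
    by (simp add: Foralls_def)
qed (simp add: Foralls_def)

lemma subst_disjs: "subst x t (disjs \<phi>s) = disjs (map (subst x t) \<phi>s)"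
  by (induction \<phi>s) (auto simp: disjs_def)

lemma subst_imps: "subst x t (imps \<phi>s \<psi>) = imps (map (subst x t) \<phi>s) (subst x t \<psi>)"
  by (induction \<phi>s) (auto simp: imps_def)

lemma is_formula_sequent_fm:
  assumes "is_sequent S"
  shows "is_formula (sequent_fm S)"
proof -
  have "\<forall>\<phi>\<in>set \<phi>s. is_formula \<phi> \<Longrightarrow> is_formula (disjs \<phi>s)" for \<phi>s
    by (induction \<phi>s) (auto simp: disjs_def)
  moreover have "\<forall>\<phi>\<in>set \<phi>s. is_formula \<phi> \<Longrightarrow> is_formula \<psi> \<Longrightarrow> is_formula (imps \<phi>s \<psi>)" for \<phi>s \<psi>
    by (induction \<phi>s) (auto simp: imps_def)
  ultimately show ?thesis
    using assms by (auto simp: sequent_fm_def is_sequent_def)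
qed

text \<open>The substitution is applied to the formula, not to the sequent before its translation:
  the list chosen for an image set need not be the image of the chosen list.\<close>

lemma PA_subst_sequent_fm_iff:
  assumes "finite \<Gamma>" "finite \<Delta>"
  shows "PA_provable (\<Theta> \<Rrightarrow> {subst x t (sequent_fm (\<Gamma> \<Rrightarrow> \<Delta>))}) \<longleftrightarrow>
    PA_provable (\<Theta> \<union> subst x t ` \<Gamma> \<Rrightarrow> subst x t ` \<Delta>)"
  using PA_disjs_iff[of _ _ "{}"] assms
  by (simp add: sequent_fm_def subst_imps subst_disjs PA_imps_iff)

definition add_hyps :: "fm set \<Rightarrow> sequent \<Rightarrow> sequent" where
  "add_hyps \<Theta> S = (\<Theta> \<union> antecedent S \<Rrightarrow> succedent S)"

lemma PA_sequent_fm_iff: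
  assumes "is_sequent S"
  shows "PA_provable (\<Theta> \<Rrightarrow> {sequent_fm S}) \<longleftrightarrow> PA_provable (add_hyps \<Theta> S)"
  \<comment> \<open>Replacing a variable by itself is the identity substitution.\<close>
  using PA_subst_sequent_fm_iff[of "antecedent S" "succedent S" \<Theta> 0 "Var 0"] assms
  by (simp add: add_hyps_def is_sequent_def)

lemma PA_add_hyps_mono:
  assumes "PA_provable (add_hyps \<Theta> S)" "\<Theta> \<subseteq> \<Theta>'" "is_sequent (\<Theta>' \<Rrightarrow> {})"
  shows "PA_provable (add_hyps \<Theta>' S)"
  unfolding add_hyps_def
  by (rule PA_weaken[OF assms(1)[unfolded add_hyps_def]])
    (use assms(2,3) PA_provable_is_sequent[OF assms(1)] in
      \<open>auto simp: is_sequent_iff add_hyps_def\<close>)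

section \<open>Induction on a trace variable\<close>

text \<open>Without a predecessor symbol, the predecessor is reached through a quantified equation.
  This makes the formula vacuous at zero.\<close>

definition at_pred :: "var \<Rightarrow> var \<Rightarrow> fm \<Rightarrow> fm" where
  "at_pred x z \<phi> = Forall z (Imp (Eq (Var x) (Succ (Var z))) (subst x (Var z) \<phi>))"

lemma is_formula_at_pred [simp]: "is_formula \<phi> \<Longrightarrow> is_formula (at_pred x z \<phi>)"
  by (simp add: at_pred_def)

lemma fv_at_pred: "fv (at_pred x z \<phi>) \<subseteq> insert x (fv \<phi>)"
  using fv_subst[of x "Var z" \<phi>] by (auto simp: at_pred_def)

text \<open>Renaming to \<open>z\<close> has already removed \<open>x\<close> from the body, so only
  the equation is affected.\<close>

lemma subst_at_pred:
  assumes "z \<noteq> x" "z \<notin> fv_tm t"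
  shows "subst x t (at_pred x z \<phi>) = Forall z (Imp (Eq t (Succ (Var z))) (subst x (Var z) \<phi>))"
proof -
  have "subst x t (subst x (Var z) \<phi>) = subst x (Var z) \<phi>"
    using fv_subst[of x "Var z" \<phi>] assms(1) by (intro subst_fresh) auto
  then show ?thesis
    using assms by (simp add: at_pred_def subst_Forall)
qed

lemma PA_at_pred_Zero:
  assumes "z \<noteq> x" "is_formula \<phi>"
  shows "PA_provable ({} \<Rrightarrow> {subst x Zero (at_pred x z \<phi>)})"
proof -
  have "PA_provable ({} \<Rrightarrow> {Neg (Eq Zero (Succ (Var z)))})"
    by (rule PA_basic[OF basic_rule.Zero_neq_Succ]) (auto simp: is_sequent_iff)
  then have "PA_provable ({Eq Zero (Succ (Var z))} \<Rrightarrow> {})"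
    by (simp add: PA_Imp_iff PA_Falsity_iff)
  then have "PA_provable ({Eq Zero (Succ (Var z))} \<Rrightarrow> {subst x (Var z) \<phi>})"
    by (rule PA_weaken) (use assms in \<open>auto simp: is_sequent_iff\<close>)
  then show ?thesis
    using assms by (simp add: subst_at_pred PA_AllI PA_Imp_iff)
qed

text \<open>Injectivity of the successor turns the equation into \<open>x = z\<close>, along which
  \<open>\<phi>\<close> is rewritten.\<close>

lemma PA_at_pred_SuccI:
  assumes "z \<noteq> x" "z \<notin> fv \<phi>" "is_formula \<phi>"
  shows "PA_provable ({\<phi>} \<Rrightarrow> {subst x (Succ (Var x)) (at_pred x z \<phi>)})"
proof -
  let ?eq = "Eq (Var x) (Var z)" and ?Eq = "Eq (Succ (Var x)) (Succ (Var z))"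
  have "PA_provable ({?Eq} \<Rrightarrow> {?eq})"
    by (rule PA_basic[OF basic_rule.Succ_inj]) (auto simp: is_sequent_iff)
  then have "PA_provable ({?Eq, \<phi>} \<Rrightarrow> {?eq})"
    by (rule PA_weaken) (use assms in \<open>auto simp: is_sequent_iff\<close>)
  moreover have "PA_provable ({?eq, \<phi>} \<Rrightarrow> {subst x (Var z) \<phi>})"
    using PA_eq_subst[of "Var x" "Var z" \<phi> x] assms by simp
  then have "PA_provable ({?eq, ?Eq, \<phi>} \<Rrightarrow> {subst x (Var z) \<phi>})"
    by (rule PA_weaken) (use assms in \<open>auto simp: is_sequent_iff\<close>)
  ultimately have "PA_provable ({?Eq, \<phi>} \<Rrightarrow> {subst x (Var z) \<phi>})"
    by (rule PA_cut_single)
  then show ?thesis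
    using assms by (simp add: subst_at_pred PA_AllI PA_Imp_iff)
qed

text \<open>Instantiate \<open>z\<close> by \<open>x\<close> and discharge the equation by
  reflexivity.\<close>

lemma PA_at_pred_SuccE:
  assumes "z \<noteq> x" "z \<notin> fv \<phi>" "is_formula \<phi>" "is_sequent (\<Gamma> \<Rrightarrow> {})"
  shows "PA_provable (insert (subst x (Succ (Var x)) (at_pred x z \<phi>)) \<Gamma> \<Rrightarrow> {\<phi>})"
proof -
  let ?B = "subst x (Succ (Var x)) (at_pred x z \<phi>)" and ?refl = "Eq (Succ (Var x)) (Succ (Var x))"
  have seq: "is_sequent (insert ?B \<Gamma> \<Rrightarrow> {?B, ?refl})"
    using assms by (auto simp: is_sequent_iff)
  have "PA_provable (insert ?B \<Gamma> \<Rrightarrow> {?B})"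
    by (rule PA_axiom) (use seq in \<open>auto simp: is_sequent_iff\<close>)
  then have "PA_provable (insert ?B \<Gamma> \<Rrightarrow> {subst z (Var x)
      (Imp (Eq (Succ (Var x)) (Succ (Var z))) (subst x (Var z) \<phi>))})"
    using assms by (intro PA_AllE) (simp_all add: subst_at_pred)
  then have "PA_provable (insert ?refl (insert ?B \<Gamma>) \<Rrightarrow> {\<phi>})"
    using assms by (simp add: subst_subst_Var PA_Imp_iff)
  moreover have "PA_provable (insert ?B \<Gamma> \<Rrightarrow> {?refl})"
    by (rule PA_basic[OF basic_rule.EqR]) (use seq in \<open>auto simp: is_sequent_iff\<close>)
  ultimately show ?thesis by (rule PA_cut_single[rotated])
qed

lemma PA_induct_at_pred:
  assumes "z \<noteq> x" "z \<notin> fv \<phi>" "x \<notin> fv_set \<Gamma>"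
    and step: "PA_provable (insert (at_pred x z \<phi>) \<Gamma> \<Rrightarrow> {\<phi>})"
  shows "PA_provable (\<Gamma> \<Rrightarrow> {\<phi>})"
proof -
  have seq: "is_sequent (\<Gamma> \<Rrightarrow> {\<phi>})"
    using PA_provable_is_sequent[OF step] by (auto simp: is_sequent_iff)
  \<comment> \<open>\<open>PA_subst\<close> wants \<open>x\<close> absent from the context, so
    \<open>at_pred x z \<phi>\<close> is first moved to the right as the premise of an
    implication.\<close>
  have inst: "PA_provable (insert (subst x t (at_pred x z \<phi>)) \<Gamma> \<Rrightarrow> {subst x t \<phi>})"
    if "is_term t" for t
    using PA_subst[of \<Gamma> "Imp (at_pred x z \<phi>) \<phi>" x t] step assms(3) that by (simp add: PA_Imp_iff)
  show ?thesis
  proof (rule PA_induct)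
    have "PA_provable (\<Gamma> \<Rrightarrow> {subst x Zero (at_pred x z \<phi>)})"
      by (rule PA_weaken[OF PA_at_pred_Zero]) (use seq assms(1) in \<open>auto simp: is_sequent_iff\<close>)
    then show "PA_provable (\<Gamma> \<Rrightarrow> {subst x Zero \<phi>})"
      by (rule PA_cut_single) (simp add: inst)
    let ?B = "subst x (Succ (Var x)) (at_pred x z \<phi>)"
    have "PA_provable (insert \<phi> \<Gamma> \<Rrightarrow> {?B})"
      by (rule PA_weaken[OF PA_at_pred_SuccI]) (use seq assms(1,2) in \<open>auto simp: is_sequent_iff\<close>)
    moreover have "PA_provable (insert ?B (insert \<phi> \<Gamma>) \<Rrightarrow> {subst x (Succ (Var x)) \<phi>})"
      by (rule PA_weaken[OF inst]) (use seq in \<open>auto simp: is_sequent_iff\<close>)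
    ultimately show "PA_provable (insert \<phi> \<Gamma> \<Rrightarrow> {subst x (Succ (Var x)) \<phi>})"
      by (rule PA_cut_single)
  qed fact
qed

section \<open>Local soundness of the rules under additional hypotheses\<close>

lemma EqL_add_hyps:
  assumes "is_term s" "is_term t" "finite \<Theta>"
    and seq: "is_sequent (\<Theta> \<union> insert (Eq s t) (subst x s ` \<Gamma>) \<Rrightarrow> subst x s ` \<Delta>)"
    and prem: "PA_provable (\<Theta> \<union> subst x t ` \<Gamma> \<Rrightarrow> subst x t ` \<Delta>)"
  shows "PA_provable (\<Theta> \<union> insert (Eq s t) (subst x s ` \<Gamma>) \<Rrightarrow> subst x s ` \<Delta>)"
proof -
  \<comment> \<open>\<open>\<Gamma>\<close> and \<open>\<Delta>\<close> are not assumed finite, so a fresh variable exists only after thinning them.\<close>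
  have *: "\<exists>\<Gamma>0\<subseteq>\<Gamma>. finite \<Gamma>0 \<and> subst x s ` \<Gamma>0 = subst x s ` \<Gamma> \<and> subst x t ` \<Gamma>0 = subst x t ` \<Gamma>"
    if fin: "finite (subst x s ` \<Gamma>)" "finite (subst x t ` \<Gamma>)" for \<Gamma>
  proof -
    obtain \<Gamma>1 where 1: "\<Gamma>1 \<subseteq> \<Gamma>" "finite \<Gamma>1" "subst x s ` \<Gamma> = subst x s ` \<Gamma>1"
      using finite_subset_image[OF fin(1) order_refl] by blast
    obtain \<Gamma>2 where 2: "\<Gamma>2 \<subseteq> \<Gamma>" "finite \<Gamma>2" "subst x t ` \<Gamma> = subst x t ` \<Gamma>2"
      using finite_subset_image[OF fin(2) order_refl] by blast
    have "subst x s ` (\<Gamma>1 \<union> \<Gamma>2) = subst x s ` \<Gamma>"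
      unfolding image_Un 1(3)[symmetric] using 2(1) by blast
    moreover have "subst x t ` (\<Gamma>1 \<union> \<Gamma>2) = subst x t ` \<Gamma>"
      unfolding image_Un 2(3)[symmetric] using 1(1) by blast
    ultimately show ?thesis
      using 1(1,2) 2(1,2) by (intro exI[of _ "\<Gamma>1 \<union> \<Gamma>2"]) blast
  qed
  obtain \<Gamma>0 where \<Gamma>0: "finite \<Gamma>0" "subst x s ` \<Gamma>0 = subst x s ` \<Gamma>" "subst x t ` \<Gamma>0 = subst x t ` \<Gamma>"
    using *[of \<Gamma>] seq PA_provable_is_sequent[OF prem] by (auto simp: is_sequent_iff)
  obtain \<Delta>0 where \<Delta>0: "finite \<Delta>0" "subst x s ` \<Delta>0 = subst x s ` \<Delta>" "subst x t ` \<Delta>0 = subst x t ` \<Delta>"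
    using *[of \<Delta>] seq PA_provable_is_sequent[OF prem] by (auto simp: is_sequent_iff)
  obtain z where z: "z \<notin> fv_set (\<Gamma>0 \<union> \<Delta>0 \<union> \<Theta>)"
    using ex_new_if_finite[OF infinite_UNIV_nat, of "fv_set (\<Gamma>0 \<union> \<Delta>0 \<union> \<Theta>)"] \<Gamma>0(1) \<Delta>0(1) assms(3)
    by auto
  \<comment> \<open>The rule is applied at \<open>z\<close>, since \<open>x\<close> may occur in \<open>\<Theta>\<close>.\<close>
  have rename: "subst z r ` subst x (Var z) ` \<Phi> = subst x r ` \<Phi>" if "z \<notin> fv_set \<Phi>" for r \<Phi>
    using that by (force simp: fv_set_def image_image subst_subst_Var intro!: image_cong)
  have fresh: "subst z r ` \<Theta> = \<Theta>" for r
    using z by (force simp: fv_set_def subst_fresh)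
  have "basic_rule [\<Theta> \<union> subst x t ` \<Gamma> \<Rrightarrow> subst x t ` \<Delta>]
      (insert (Eq s t) (\<Theta> \<union> subst x s ` \<Gamma>) \<Rrightarrow> subst x s ` \<Delta>)"
    using basic_rule.EqL[OF assms(1,2), of z "\<Theta> \<union> subst x (Var z) ` \<Gamma>0" "subst x (Var z) ` \<Delta>0"] z
    by (simp add: image_Un fresh rename \<Gamma>0 \<Delta>0)
  from PA_basic[OF this] show ?thesis using seq prem by simp
qed

text \<open>Most rules keep their shape when \<Theta> joins the antecedent. Only the eigenvariable
  rules and \<open>EqL\<close>, which substitutes in the whole context, need an argument.\<close>

lemma basic_rule_add_hyps:
  assumes "basic_rule Ps C" "is_sequent C" "is_sequent (\<Theta> \<Rrightarrow> {})" "fv_set \<Theta> \<subseteq> fv_sequent C"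
    and prems: "\<forall>P\<in>set Ps. PA_provable (add_hyps \<Theta> P)"
  shows "PA_provable (add_hyps \<Theta> C)"
proof -
  have seq: "is_sequent (add_hyps \<Theta> C)"
    using assms(2,3) by (auto simp: is_sequent_def add_hyps_def)
  \<comment> \<open>The arithmetic axioms admit no context, so \<Theta> is added by
    weakening.\<close>
  have ax: "PA_provable (add_hyps \<Theta> C)" if "Ps = []"
    by (rule PA_add_hyps_mono[of "{}"])
      (use that assms PA_basic[OF assms(1,2)] in \<open>auto simp: add_hyps_def\<close>)
  show ?thesis
    using assms(1)
  proof cases
    case (AndL \<phi> \<psi> \<Gamma> \<Delta>)
    then show ?thesis using seq prems PA_basic[OF basic_rule.AndL] by (simp add: add_hyps_def)
  next
    case (AndR \<Gamma> \<phi> \<Delta> \<psi>)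
    then show ?thesis using seq prems PA_basic[OF basic_rule.AndR] by (simp add: add_hyps_def)
  next
    case (OrL \<phi> \<Gamma> \<Delta> \<psi>)
    then show ?thesis using seq prems PA_basic[OF basic_rule.OrL] by (simp add: add_hyps_def)
  next
    case (OrR \<Gamma> \<phi> \<psi> \<Delta>)
    then show ?thesis using seq prems PA_basic[OF basic_rule.OrR] by (simp add: add_hyps_def)
  next
    case (ImpL \<Gamma> \<phi> \<Delta> \<psi>)
    then show ?thesis using seq prems PA_basic[OF basic_rule.ImpL] by (simp add: add_hyps_def)
  next
    case (ImpR \<phi> \<Gamma> \<psi> \<Delta>)
    then show ?thesis using seq prems PA_basic[OF basic_rule.ImpR] by (simp add: add_hyps_def)
  next
    case (AllL t x \<phi> \<Gamma> \<Delta>)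
    then show ?thesis using seq prems PA_basic[OF basic_rule.AllL] by (simp add: add_hyps_def)
  next
    case (AllR x \<Gamma> \<Delta> \<phi>)
    \<comment> \<open>The eigenvariable is bound in the principal formula and absent from the
      context, hence not free in the conclusion and so not in \<Theta>.\<close>
    then have "x \<notin> fv_set (\<Theta> \<union> \<Gamma>) \<union> fv_set \<Delta>" using assms(4) by (auto simp: fv_sequent_def)
    from PA_basic[OF basic_rule.AllR[OF this]] show ?thesis
      using AllR seq prems by (simp add: add_hyps_def)
  next
    case (ExL x \<Gamma> \<Delta> \<phi>)
    then have "x \<notin> fv_set (\<Theta> \<union> \<Gamma>) \<union> fv_set \<Delta>" using assms(4) by (auto simp: fv_sequent_def)
    from PA_basic[OF basic_rule.ExL[OF this]] show ?thesis
      using ExL seq prems by (simp add: add_hyps_def)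
  next
    case (ExR t \<Gamma> x \<phi> \<Delta>)
    then show ?thesis using seq prems PA_basic[OF basic_rule.ExR] by (simp add: add_hyps_def)
  next
    case (EqL s t x \<Gamma> \<Delta>)
    then show ?thesis
      using seq prems EqL_add_hyps[of s t \<Theta> x \<Gamma> \<Delta>] assms(3)
      by (simp add: add_hyps_def is_sequent_iff)
  next
    case (Weak \<Gamma> \<Gamma>' \<Delta> \<Delta>')
    then have "basic_rule [\<Theta> \<union> \<Gamma> \<Rrightarrow> \<Delta>] (\<Theta> \<union> \<Gamma>' \<Rrightarrow> \<Delta>')"
      by (intro basic_rule.Weak) auto
    from PA_basic[OF this] show ?thesis using Weak seq prems by (simp add: add_hyps_def)
  next
    case (Cut \<Gamma> \<phi> \<Delta>)
    then show ?thesis using prems by (auto simp: add_hyps_def intro: PA_cut)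
  qed (use ax in auto)
qed

text \<open>The premises of a \<open>Case\<close> rule substitute for its variable in the sequent
  but not in \<Theta>, which is why that variable must not occur in \<Theta>.\<close>

lemma CPA_rule_add_hyps:
  assumes "CPA_rule r Ps C" "is_sequent C" "is_sequent (\<Theta> \<Rrightarrow> {})" "fv_set \<Theta> \<subseteq> fv_sequent C"
    and "\<And>y. r = CaseRule y \<Longrightarrow> y \<notin> fv_set \<Theta>"
    and prems: "\<forall>P\<in>set Ps. PA_provable (add_hyps \<Theta> P)"
  shows "PA_provable (add_hyps \<Theta> C)"
  using assms(1)
proof cases
  case Basic
  then show ?thesis using assms by (auto intro: basic_rule_add_hyps)
next
  case (Case y \<Gamma> \<Delta>)
  have fin: "finite \<Gamma>" "finite \<Delta>" using assms(2) Case by (auto simp: is_sequent_iff)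
  have "PA_provable (\<Theta> \<Rrightarrow> {sequent_fm (\<Gamma> \<Rrightarrow> \<Delta>)})"
    by (rule PA_cases[of _ y])
      (use prems Case assms(2,5) fin in
        \<open>auto simp: PA_subst_sequent_fm_iff add_hyps_def is_formula_sequent_fm\<close>)
  then show ?thesis using Case assms(2) by (simp add: PA_sequent_fm_iff)
qed

section \<open>Nodes and branches\<close>

definition step :: "derivation \<Rightarrow> node \<Rightarrow> node \<Rightarrow> bool" where
  "step D v w \<longleftrightarrow> v \<in> nodes D \<and> w \<in> nodes D \<and>
     ((\<exists>i. w = v @ [i]) \<or> companion D v = Some w)"

text \<open>The child indices form a finite downward closed set, that is, an initial segment, whose
  length is its cardinality.\<close>

lemma child_iff:
  assumes "finite_tree N"
  shows "v @ [i] \<in> N \<longleftrightarrow> i < arity N v"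
proof -
  let ?C = "{i. v @ [i] \<in> N}"
  define n where "n = (LEAST n. n \<notin> ?C)"
  have "finite ((\<lambda>i. v @ [i]) ` ?C)"
    by (rule finite_subset[of _ N]) (use assms in \<open>auto simp: finite_tree_def\<close>)
  then have "finite ?C" by (rule finite_imageD) (simp add: inj_on_def)
  then have "n \<notin> ?C" unfolding n_def by (rule LeastI_ex[OF ex_new_if_finite[OF infinite_UNIV_nat]])
  moreover have "\<forall>j<k. j \<in> ?C" if "k \<in> ?C" for k
    using assms that unfolding finite_tree_def by blast
  ultimately have "?C = {..<n}"
    using not_less_Least[of _ "\<lambda>n. n \<notin> ?C"] unfolding n_def[symmetric]
    by (auto simp: not_less le_less) (metis linorder_neqE_nat)
  then have "arity N v = n" by (simp add: arity_def)
  with \<open>?C = {..<n}\<close> show ?thesis by blast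
qed

text \<open>Buds and rule instances are treated alike: the only step from a bud leads to its
  companion, which carries the same sequent.\<close>

lemma node_sound:
  assumes "preproof D" "v \<in> nodes D" "is_sequent (\<Theta> \<Rrightarrow> {})" "fv_set \<Theta> \<subseteq> fv_sequent (seq_at D v)"
    and "\<And>y. companion D v = None \<Longrightarrow> rule_at D v = CaseRule y \<Longrightarrow> y \<notin> fv_set \<Theta>"
    and succ: "\<And>w. step D v w \<Longrightarrow> PA_provable (add_hyps \<Theta> (seq_at D w))"
  shows "PA_provable (add_hyps \<Theta> (seq_at D v))"
proof (cases "companion D v")
  case None
  show ?thesis
  proof (rule CPA_rule_add_hyps)
    show "CPA_rule (rule_at D v)
        (map (\<lambda>i. seq_at D (v @ [i])) [0..<arity (nodes D) v]) (seq_at D v)"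
      using assms(1,2) None by (simp add: preproof_def)
    show "\<forall>P\<in>set (map (\<lambda>i. seq_at D (v @ [i])) [0..<arity (nodes D) v]).
        PA_provable (add_hyps \<Theta> P)"
      using assms(1,2) by (auto intro!: succ simp: step_def preproof_def child_iff)
    show "is_sequent (seq_at D v)"
      using assms(1,2) by (simp add: preproof_def)
  qed (use assms(3-5) None in simp_all)
next
  case (Some c)
  then have "step D v c" "seq_at D v = seq_at D c"
    using assms(1,2) by (auto simp: step_def preproof_def inner_node_def)
  then show ?thesis using succ by metis
qed

section \<open>Infinite branches around a cycle\<close>

lemma take_in_tree: "finite_tree N \<Longrightarrow> v \<in> N \<Longrightarrow> take n v \<in> N"
proof (induction v rule: rev_induct)
  case (snoc i v)
  then have "v \<in> N" by (auto simp: finite_tree_def)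
  with snoc show ?case by (cases "n \<le> length v") auto
qed auto

text \<open>The stem consists of the prefixes of \<open>ws ! 0\<close>, which lead down from the
  root; afterwards the branch goes round \<open>ws\<close> forever.\<close>

lemma infinite_branch_lasso:
  assumes "finite_tree (nodes D)" "ws \<noteq> []"
    and steps: "\<And>k. k < length ws \<Longrightarrow> step D (ws ! k) (ws ! (Suc k mod length ws))"
  shows "infinite_branch D (\<lambda>n. if n < length (ws ! 0) then take n (ws ! 0)
    else ws ! ((n - length (ws ! 0)) mod length ws))" (is "infinite_branch D ?b")
  unfolding infinite_branch_def
proof (intro conjI allI)
  let ?v = "ws ! 0" and ?l = "length (ws ! 0)"
  have v: "?v \<in> nodes D" using steps[of 0] assms(2) by (simp add: step_def)
  show "?b 0 = []" by auto
  fix n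
  have *: "step D (?b n) (?b (Suc n))" if "\<not> n < ?l"
    using steps[of "(n - ?l) mod length ws"] assms(2) that by (simp add: Suc_diff_le mod_Suc_eq)
  show "?b n \<in> nodes D"
    using *[unfolded step_def] take_in_tree[OF assms(1) v] by (cases "n < ?l") simp_all
  show "(\<exists>i. ?b (Suc n) = ?b n @ [i]) \<or> companion D (?b n) = Some (?b (Suc n))"
  proof (cases "n < ?l")
    case True
    \<comment> \<open>At the joint \<open>Suc n = ?l\<close> the cycle starts at
      \<open>ws ! 0\<close>, which is also the full prefix.\<close>
    then have "?b (Suc n) = take (Suc n) ?v"
      by (cases "Suc n < ?l") auto
    then show ?thesis using True by (simp add: take_Suc_conv_app_nth)
  next
    case False
    then show ?thesis using *[OF False] unfolding step_def by blast
  qed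
qed

text \<open>The lasso meets every node of \<open>ws\<close> again and again, so what holds from some
  point on along the branch holds on all of \<open>ws\<close>.\<close>

lemma cycle_trace:
  assumes "CPA_proof D" "ws \<noteq> []"
    and steps: "\<And>k. k < length ws \<Longrightarrow> step D (ws ! k) (ws ! (Suc k mod length ws))"
  obtains x c where "\<forall>w\<in>set ws. x \<in> fv_sequent (seq_at D w)"
    and "c \<in> set ws" "companion D c = None" "rule_at D c = CaseRule x"
proof -
  let ?l = "length (ws ! 0)"
  define b where "b = (\<lambda>n. if n < ?l then take n (ws ! 0) else ws ! ((n - ?l) mod length ws))"
  have "infinite_branch D b"
    unfolding b_def
  proof (rule infinite_branch_lasso[OF _ assms(2) steps])
    show "finite_tree (nodes D)" using assms(1) by (simp add: CPA_proof_def preproof_def)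
  qed
  then obtain x where "progressing_trace D b x" using assms(1) by (auto simp: CPA_proof_def)
  then obtain m where m: "\<forall>n\<ge>m. x \<in> fv_sequent (seq_at D (b n))"
    and inf: "infinite {n. companion D (b n) = None \<and> rule_at D (b n) = CaseRule x}"
    by (auto simp: progressing_trace_def)
  \<comment> \<open>The finite stem cannot hold infinitely many \<open>Case\<close> nodes, so one
    lies on the cycle.\<close>
  have "\<not> {n. companion D (b n) = None \<and> rule_at D (b n) = CaseRule x} \<subseteq> {..<?l}"
    using inf finite_subset by blast
  then have "\<exists>n\<ge>?l. companion D (b n) = None \<and> rule_at D (b n) = CaseRule x"
    by (auto simp: not_less)
  then obtain n where n: "n \<ge> ?l" "companion D (b n) = None" "rule_at D (b n) = CaseRule x"
    by blast
  have "b n \<in> set ws" using n(1) assms(2) by (simp add: b_def)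
  moreover have "x \<in> fv_sequent (seq_at D w)" if w: "w \<in> set ws" for w
  proof -
    obtain k where k: "k < length ws" "w = ws ! k" using w by (auto simp: in_set_conv_nth)
    \<comment> \<open>After \<open>m\<close> further rounds the position of \<open>w\<close> is past
      \<open>m\<close>, since a round has at least one step.\<close>
    then have "b (?l + (k + m * length ws)) = w" by (simp add: b_def)
    moreover have "m \<le> ?l + (k + m * length ws)"
      using assms(2) by (cases ws) auto
    ultimately show ?thesis using m by metis
  qed
  ultimately show thesis using that n(2,3) by blast
qed

section \<open>Closed walks through a strongly connected set\<close>

lemma trancl_imp_walk: "(a, b) \<in> E\<^sup>+ \<Longrightarrow> \<exists>p. successively (\<lambda>u w. (u, w) \<in> E) (a # p @ [b])"
proof (induction rule: trancl_induct)
  case (base b)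
  then show ?case by (intro exI[of _ "[]"]) auto
next
  case (step b c)
  then obtain p where "successively (\<lambda>u w. (u, w) \<in> E) (a # p @ [b])" by blast
  then have "successively (\<lambda>u w. (u, w) \<in> E) ((a # p @ [b]) @ [c])"
    using step.hyps(2) by (subst successively_append_iff) auto
  then show ?case by (intro exI[of _ "p @ [b]"]) auto
qed

text \<open>Walks from one element to the next are chained until all are visited, and a last one
  returns to the start. As \<open>conn\<close> covers pairs of equal elements, even a single element
  lies on a cycle.\<close>

lemma strongly_connected_imp_cycle:
  assumes "finite U" "U \<noteq> {}" and conn: "U \<times> U \<subseteq> E\<^sup>+" and "E \<subseteq> U \<times> U"
  obtains ws where "ws \<noteq> []" "set ws = U"
    "\<And>k. k < length ws \<Longrightarrow> (ws ! k, ws ! (Suc k mod length ws)) \<in> E"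
proof -
  let ?walk = "successively (\<lambda>u w. (u, w) \<in> E)"
  obtain v where v: "v \<in> U" using assms(2) by blast
  have E_U: "w \<in> U" if "(u, w) \<in> E" for u w using that assms(4) by blast
  have in_U: "set q \<subseteq> U" if "?walk (a # q)" for a q
    using that by (induction q arbitrary: a) (auto dest: E_U)
  have reach: "\<exists>p. ?walk (u # p @ [w])" if "u \<in> U" "w \<in> U" for u w
    by (rule trancl_imp_walk) (use that conn in blast)
  have append: "?walk (xs @ p @ [b])" if "?walk xs" "xs \<noteq> []" "?walk (last xs # p @ [b])" for xs p b
    using that by (cases p) (auto simp: successively_append_iff)
  \<comment> \<open>Induction on the set of elements still to be visited: each one extends the walk
    from its current end.\<close>
  have "\<exists>q. ?walk (v # q) \<and> X \<subseteq> set (v # q)" if "finite X" "X \<subseteq> U" for X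
    using that
  proof (induction X)
    case empty
    then show ?case by (intro exI[of _ "[]"]) auto
  next
    case (insert u X)
    then obtain q where q: "?walk (v # q)" "X \<subseteq> set (v # q)" by auto
    then have "last (v # q) \<in> U" using in_U[OF q(1)] v by auto
    then obtain p where "?walk (last (v # q) # p @ [u])"
      using reach[of "last (v # q)" u] insert.prems by auto
    from append[OF q(1) _ this] have "?walk (v # q @ p @ [u])" by simp
    moreover have "insert u X \<subseteq> set (v # q @ p @ [u])" using q(2) by auto
    ultimately show ?case by blast
  qed
  from this[OF assms(1)] obtain q where q: "?walk (v # q)" "U \<subseteq> set (v # q)" by auto
  have "last (v # q) \<in> U" using in_U[OF q(1)] v by auto
  then obtain p where "?walk (last (v # q) # p @ [v])"
    using reach v by meson
  note closed = append[OF q(1) _ this]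
  \<comment> \<open>The closing \<open>v\<close> is left out, as the index modulo the length brings
    it back.\<close>
  define ws where "ws = v # q @ p"
  have ws_0: "ws ! 0 = v" by (simp add: ws_def)
  have walk: "?walk (ws @ [v])" using closed by (simp add: ws_def)
  have "(ws ! k, ws ! (Suc k mod length ws)) \<in> E" if "k < length ws" for k
  proof -
    have "((ws @ [v]) ! k, (ws @ [v]) ! Suc k) \<in> E"
      using successively_nth[OF walk, of k] that by simp
    then show ?thesis
      using that ws_0 by (cases "Suc k = length ws") (auto simp: nth_append)
  qed
  moreover have "set ws = U"
    unfolding ws_def using in_U[of v "q @ p @ [v]"] closed q(2) v by auto
  ultimately show thesis using that[of ws] by (auto simp: ws_def)
qed

section \<open>The translation\<close>

text \<open>The assumptions on the variables of \<Theta> are the invariants that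
  \<open>node_sound\<close> needs. The one on \<open>Case\<close> labels also forces each new trace
  variable to be fresh for \<Theta>.\<close>

lemma CPA_proof_imp_PA:
  assumes D: "CPA_proof D" and "U \<subseteq> nodes D" "is_sequent (\<Theta> \<Rrightarrow> {})"
    and "\<And>v w. v \<in> U \<Longrightarrow> step D v w \<Longrightarrow> w \<notin> U \<Longrightarrow> PA_provable (add_hyps \<Theta> (seq_at D w))"
    and "\<And>v. v \<in> U \<Longrightarrow> fv_set \<Theta> \<subseteq> fv_sequent (seq_at D v)"
    and "\<And>v y. v \<in> U \<Longrightarrow> companion D v = None \<Longrightarrow> rule_at D v = CaseRule y \<Longrightarrow> y \<notin> fv_set \<Theta>"
    and "u \<in> U"
  shows "PA_provable (add_hyps \<Theta> (seq_at D u))"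
  using assms(2-)
proof (induction "card U" arbitrary: U \<Theta> u rule: less_induct)
  case less
  note U = less.prems(1) and \<Theta> = less.prems(2) and exits = less.prems(3)
    and fv_\<Theta> = less.prems(4) and case_\<Theta> = less.prems(5)
  have pre: "preproof D" using D by (simp add: CPA_proof_def)
  have fin: "finite U"
    using U pre by (auto simp: preproof_def finite_tree_def intro: finite_subset)
  define E where "E = {(v, w). step D v w \<and> v \<in> U \<and> w \<in> U}"
  show ?case
  proof (cases "\<exists>v\<in>U. E\<^sup>+ `` {v} \<noteq> U")
    case True
    then obtain v where v: "v \<in> U" and ne: "E\<^sup>+ `` {v} \<noteq> U" by blast
    \<comment> \<open>The set of nodes reachable from \<open>v\<close> inside \<open>U\<close> by at
      least one step. It is closed under steps inside \<open>U\<close>, so it has no exits other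
      than those of \<open>U\<close>.\<close>
    let ?R = "E\<^sup>+ `` {v}"
    have "E\<^sup>+ \<subseteq> U \<times> U" by (rule trancl_subset_Sigma) (auto simp: E_def)
    then have R: "?R \<subset> U" using ne by auto
    have closed: "w' \<in> ?R" if "w \<in> insert v ?R" "step D w w'" "w' \<in> U" for w w'
      using that v R by (auto simp: E_def intro: trancl_into_trancl)
    have prov_R: "PA_provable (add_hyps \<Theta> (seq_at D w))" if "w \<in> ?R" for w
    proof (rule less.hyps[OF psubset_card_mono[OF fin R]])
      show "PA_provable (add_hyps \<Theta> (seq_at D w'))" if "w \<in> ?R" "step D w w'" "w' \<notin> ?R" for w w'
        using that R exits closed by blast
    qed (use R U \<Theta> fv_\<Theta> case_\<Theta> that in blast)+
    \<comment> \<open>Every step from \<open>v\<close> leads into \<open>?R\<close> or out of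
      \<open>U\<close>. Treating \<open>v\<close> separately makes the remaining set smaller than
      \<open>U\<close> even if \<open>?R\<close> is empty.\<close>
    have prov_v: "PA_provable (add_hyps \<Theta> (seq_at D v))"
    proof (rule node_sound[OF pre])
      show "PA_provable (add_hyps \<Theta> (seq_at D w))" if "step D v w" for w
        using that v exits closed prov_R by blast
    qed (use v U \<Theta> fv_\<Theta> case_\<Theta> in blast)+
    have "PA_provable (add_hyps \<Theta> (seq_at D w))" if "w \<in> U - insert v ?R" for w
    proof (rule less.hyps[of "U - insert v ?R"])
      show "card (U - insert v ?R) < card U"
        using v by (intro psubset_card_mono[OF fin]) blast
      show "PA_provable (add_hyps \<Theta> (seq_at D w'))"
        if "w \<in> U - insert v ?R" "step D w w'" "w' \<notin> U - insert v ?R" for w w'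
        using that exits prov_R prov_v by blast
    qed (use U \<Theta> fv_\<Theta> case_\<Theta> that in blast)+
    then show ?thesis using prov_R prov_v less.prems(6) by blast
  next
    case False
    then have "U \<times> U \<subseteq> E\<^sup>+" by auto
    moreover have "U \<noteq> {}" "E \<subseteq> U \<times> U" using less.prems(6) by (auto simp: E_def)
    ultimately obtain ws where ws: "ws \<noteq> []" "set ws = U"
        "\<And>k. k < length ws \<Longrightarrow> (ws ! k, ws ! (Suc k mod length ws)) \<in> E"
      using strongly_connected_imp_cycle[OF fin] by metis
    then obtain x c where x: "\<forall>w\<in>U. x \<in> fv_sequent (seq_at D w)"
      and c: "c \<in> U" "companion D c = None" "rule_at D c = CaseRule x"
      using cycle_trace[OF D ws(1)] by (metis (mono_tags, lifting) E_def case_prodD mem_Collect_eq)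
    have x_\<Theta>: "x \<notin> fv_set \<Theta>" using case_\<Theta> c by blast
    have seq: "is_sequent (seq_at D v)" if "v \<in> nodes D" for v
      using pre that by (auto simp: preproof_def)
    have fin_\<Theta>: "finite \<Theta>" "\<forall>\<phi>\<in>\<Theta>. is_formula \<phi>" using \<Theta> by (auto simp: is_sequent_iff)

    define F where "F = conjs (map (\<lambda>v. sequent_fm (seq_at D v)) ws)"
    \<comment> \<open>Sparing only \<open>x\<close> and the variables of \<Theta> keeps the
      variables of \<open>B\<close> within those free in every sequent of \<open>U\<close>.\<close>
    define xs where "xs = list_of (fv F - insert x (fv_set \<Theta>))"
    define A where "A = Foralls xs F"
    have "is_formula (conjs (map (\<lambda>v. sequent_fm (seq_at D v)) vs))" if "set vs \<subseteq> U" for vs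
      using that seq U by (induction vs) (auto simp: conjs_def intro: is_formula_sequent_fm)
    then have F: "is_formula F" using ws(2) by (simp add: F_def)
    have set_xs: "set xs = fv F - insert x (fv_set \<Theta>)" by (simp add: xs_def)
    have A: "is_formula A" and fv_A: "fv A \<subseteq> insert x (fv_set \<Theta>)"
      using F by (auto simp: A_def set_xs)
    obtain z where z: "z \<notin> insert x (fv_set \<Theta>)"
      using ex_new_if_finite[OF infinite_UNIV_nat, of "insert x (fv_set \<Theta>)"] fin_\<Theta> by auto
    define B where "B = at_pred x z A"
    have B: "is_formula B" and fv_B: "fv B \<subseteq> insert x (fv_set \<Theta>)"
      using A fv_A fv_at_pred[of x z A] by (auto simp: B_def)
    have \<Theta>B: "is_sequent (insert B \<Theta> \<Rrightarrow> {})" using \<Theta> B by (simp add: is_sequent_iff)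
    have A_elim: "PA_provable (add_hyps \<Gamma> (seq_at D v))"
      if "PA_provable (\<Gamma> \<Rrightarrow> {A})" "v \<in> U" for \<Gamma> v
    proof -
      have "PA_provable (\<Gamma> \<Rrightarrow> {sequent_fm (seq_at D v)})"
        using PA_conjsE[OF PA_ForallsE[OF that(1)[unfolded A_def] F, unfolded F_def]] that(2) ws(2)
        by auto
      then show ?thesis using that(2) U seq by (auto simp: PA_sequent_fm_iff)
    qed

    \<comment> \<open>The zero premise is an exit. The successor premise is an exit too or follows
      from \<open>A\<close>, which \<open>B\<close> yields at the successor of
      \<open>x\<close>.\<close>
    have case_node: "PA_provable (add_hyps (insert B \<Theta>) (seq_at D v))"
      if v: "v \<in> U" "companion D v = None" "rule_at D v = CaseRule x" for v
    proof -
      obtain \<Gamma> \<Delta> where S: "seq_at D v = (\<Gamma> \<Rrightarrow> \<Delta>)" by (cases "seq_at D v")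
      have nodes: "v \<in> nodes D" using v(1) U by blast
      have \<Gamma>\<Delta>: "finite \<Gamma>" "finite \<Delta>" "is_formula (sequent_fm (\<Gamma> \<Rrightarrow> \<Delta>))"
        using seq[OF nodes] is_formula_sequent_fm[OF seq[OF nodes]] by (simp_all add: S is_sequent_iff)
      have tree: "finite_tree (nodes D)" using pre by (simp add: preproof_def)
      have "CPA_rule (CaseRule x) (map (\<lambda>i. seq_at D (v @ [i])) [0..<arity (nodes D) v]) (\<Gamma> \<Rrightarrow> \<Delta>)"
        using pre nodes v(2,3) S by (metis preproof_def)
      then have prems: "map (\<lambda>i. seq_at D (v @ [i])) [0..<arity (nodes D) v] =
        [subst x Zero ` \<Gamma> \<Rrightarrow> subst x Zero ` \<Delta>,
         subst x (Succ (Var x)) ` \<Gamma> \<Rrightarrow> subst x (Succ (Var x)) ` \<Delta>]"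
        by cases auto
      then have ar: "arity (nodes D) v = 2" by (auto dest: arg_cong[of _ _ length])
      have left: "seq_at D (v @ [0]) = (subst x Zero ` \<Gamma> \<Rrightarrow> subst x Zero ` \<Delta>)"
        and right: "seq_at D (v @ [1]) = (subst x (Succ (Var x)) ` \<Gamma> \<Rrightarrow> subst x (Succ (Var x)) ` \<Delta>)"
        using prems by (simp_all add: ar upt_rec)
      have step: "step D v (v @ [0])" "step D v (v @ [1])"
        using nodes child_iff[OF tree, of v] by (auto simp: step_def ar)
      \<comment> \<open>Substituting zero removes \<open>x\<close>, but \<open>x\<close> is free
        throughout \<open>U\<close>, so this child lies outside \<open>U\<close>.\<close>
      have "x \<notin> fv (subst x Zero \<phi>)" for \<phi> using fv_subst[of x Zero \<phi>] by auto
      then have "x \<notin> fv_sequent (seq_at D (v @ [0]))"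
        by (auto simp: left fv_sequent_def fv_set_def)
      then have "v @ [0] \<notin> U" using x by blast
      then have "PA_provable (\<Theta> \<Rrightarrow> {subst x Zero (sequent_fm (\<Gamma> \<Rrightarrow> \<Delta>))})"
        using exits[OF v(1) step(1)] left by (simp add: PA_subst_sequent_fm_iff \<Gamma>\<Delta> add_hyps_def)
      then have 0: "PA_provable (insert (subst x Zero B) \<Theta> \<Rrightarrow> {subst x Zero (sequent_fm (\<Gamma> \<Rrightarrow> \<Delta>))})"
        by (rule PA_weaken) (use \<Gamma>\<Delta> B \<Theta> in \<open>auto simp: is_sequent_iff\<close>)
      let ?B = "subst x (Succ (Var x)) B"
      have \<Theta>B': "is_sequent (insert ?B \<Theta> \<Rrightarrow> {})" using \<Theta> B by (simp add: is_sequent_iff)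
      have "PA_provable (add_hyps (insert ?B \<Theta>) (seq_at D (v @ [1])))"
      proof (cases "v @ [1] \<in> U")
        case True
        then show ?thesis
          using A_elim[OF PA_at_pred_SuccE[of z x A \<Theta>, folded B_def]] z fv_A A \<Theta> by blast
      next
        case False
        then show ?thesis
          using PA_add_hyps_mono[OF exits[OF v(1) step(2)] _ \<Theta>B'] by blast
      qed
      then have 1: "PA_provable (insert ?B \<Theta> \<Rrightarrow> {subst x (Succ (Var x)) (sequent_fm (\<Gamma> \<Rrightarrow> \<Delta>))})"
        using right by (simp add: PA_subst_sequent_fm_iff \<Gamma>\<Delta> add_hyps_def)
      \<comment> \<open>\<open>B\<close> contains \<open>x\<close>, so it joins the formula on which
        cases are distinguished instead of staying in the context.\<close>
      have "PA_provable (\<Theta> \<Rrightarrow> {Imp B (sequent_fm (\<Gamma> \<Rrightarrow> \<Delta>))})"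
        by (rule PA_cases[of _ x]) (use 0 1 x_\<Theta> B \<Gamma>\<Delta> in \<open>simp_all add: PA_Imp_iff\<close>)
      then show ?thesis
        using seq[OF nodes] by (simp add: PA_Imp_iff S PA_sequent_fm_iff)
    qed

    \<comment> \<open>The dropped nodes, \<open>c\<close> among them, become exits that
      \<open>case_node\<close> proves. The \<open>Case\<close> nodes left are on variables other
      than \<open>x\<close>, so \<open>B\<close> may join the hypotheses.\<close>
    let ?U = "{v \<in> U. \<not> (companion D v = None \<and> rule_at D v = CaseRule x)}"
    have prov: "PA_provable (add_hyps (insert B \<Theta>) (seq_at D v))" if "v \<in> U" for v
    proof (cases "v \<in> ?U")
      case True
      show ?thesis
      proof (rule less.hyps[of ?U])
        show "card ?U < card U" using c by (intro psubset_card_mono[OF fin]) blast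
        show "PA_provable (add_hyps (insert B \<Theta>) (seq_at D w'))"
          if "w \<in> ?U" "step D w w'" "w' \<notin> ?U" for w w'
        proof (cases "w' \<in> U")
          case True
          then show ?thesis using that(3) case_node by blast
        next
          case False
          then show ?thesis
            using that exits[of w w'] PA_add_hyps_mono[OF _ _ \<Theta>B] by blast
        qed
        show "fv_set (insert B \<Theta>) \<subseteq> fv_sequent (seq_at D w)" if "w \<in> ?U" for w
          using that fv_\<Theta>[of w] x fv_B by auto
        show "y \<notin> fv_set (insert B \<Theta>)"
          if "w \<in> ?U" "companion D w = None" "rule_at D w = CaseRule y" for w y
          using that case_\<Theta>[of w y] fv_B by auto
      qed (use U \<Theta>B True in auto)
    next
      case False
      then show ?thesis using case_node that by blast
    qed
    have "PA_provable (insert B \<Theta> \<Rrightarrow> {F})"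
      unfolding F_def using prov ws(2) U seq \<Theta>B
      by (intro PA_conjsI) (auto simp: PA_sequent_fm_iff)
    \<comment> \<open>The variables in \<open>xs\<close> avoid \<Theta> and \<open>x\<close>, hence
      also \<open>B\<close>, so they can be generalised.\<close>
    then have "PA_provable (insert B \<Theta> \<Rrightarrow> {A})"
      unfolding A_def using fv_B by (intro PA_ForallsI) (auto simp: set_xs)
    then have "PA_provable (\<Theta> \<Rrightarrow> {A})"
      using PA_induct_at_pred[of z x A \<Theta>] z fv_A x_\<Theta> by (auto simp: B_def)
    then show ?thesis using A_elim less.prems(6) by blast
  qed
qed

theorem theorem6p2:
  fixes \<Gamma> \<Delta> :: "fm set"
  assumes "is_sequent (\<Gamma> \<Rrightarrow> \<Delta>)"
    and "CPA_provable (\<Gamma> \<Rrightarrow> \<Delta>)"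
  shows "PA_provable (\<Gamma> \<Rrightarrow> \<Delta>)"
proof -
  from assms(2) obtain D where D: "CPA_proof D" and root: "seq_at D [] = (\<Gamma> \<Rrightarrow> \<Delta>)"
    by (auto simp: CPA_provable_def)
  have "PA_provable (add_hyps {} (seq_at D []))"
  \<comment> \<open>All nodes at once and no hypotheses: steps never leave \<open>nodes D\<close>,
    so there are no exits to prove.\<close>
  proof (rule CPA_proof_imp_PA[OF D, of "nodes D"])
    show "[] \<in> nodes D"
      using D by (auto simp: CPA_proof_def preproof_def finite_tree_def)
  qed (auto simp: step_def is_sequent_iff)
  then show ?thesis by (simp add: root add_hyps_def)
qed

end
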